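(* Let $Q(z)=\sum_{j=1}^dz_jQ_j$ with $Q_j\in M_{s\times r}$ be an $s\times r$ matrix of linear polynomials, and let $\mathbb{D}_Q=\{z\in\mathbb{C}^d:\|Q(z)\|<1\}$ be the corresponding matrix unit ball. Let $f\in\mathcal{SA}(\mathbb{D}_Q)$ be a non-constant function admitting a unitary realization $$f(z)=A+B\bigl[I-(Q(z)\otimes I_{\mathcal{H}})D\bigr]^{-1}(Q(z)\otimes I_{\mathcal{H}})C\qquad\text{for all } z\in\mathbb{D}_Q,$$ where $\mathcal{H}$ is a Hilbert space and $$V=\begin{bmatrix}A&B\\ C&D\end{bmatrix}:\begin{bmatrix}\mathbb{C}\\ \mathbb{C}^s\otimes\mathcal{H}\end{bmatrix}\to\begin{bmatrix}\mathbb{C}\\ \mathbb{C}^r\otimes\mathcal{H}\end{bmatrix}$$ is a unitary operator. Then $$BP(f,1)\cap\partial_e\mathbb{D}_Q\subseteq\sigma_{ap}^Q(D^* ).$$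
   Context: $\|Q(z)\|$ is the operator norm of $Q(z):\mathbb{C}^r\to\mathbb{C}^s$, and $\partial\mathbb{D}_Q=\{z\in\mathbb{C}^d:\|Q(z)\|=1\}$. The (commutative) Schur--Agler class $\mathcal{SA}(\mathbb{D}_Q)$ consists of all holomorphic $f$ on $\mathbb{D}_Q$ such that $\|f(T)\|\le1$ for every tuple $T=(T_1,\dots,T_d)$ of pairwise commuting Hilbert space operators with $\|Q(T)\|<1$; equivalently (Ambrozie--Timotin), those $f$ admitting a unitary realization of the form displayed in the claim. $BP(f)$ is the set of $\lambda\in\partial\mathbb{D}_Q$ for which $f^\dagger(\lambda):=\lim_{r\to1^-}f(r\lambda)$ exists, and $BP(f,1)=\{\lambda\in BP(f):|f^\dagger(\lambda)|<1\}$. The essential boundary is $\partial_e\mathbb{D}_Q=\partial_{\mathrm{iso}}\mathbb{D}_Q\cup\partial_{\mathrm{coiso}}\mathbb{D}_Q$, where $\partial_{\mathrm{iso}}\mathbb{D}_Q=\{\lambda\in\mathbb{C}^d:Q(\lambda)^*Q(\lambda)=I_{\mathbb{C}^r}\}$ and $\partial_{\mathrm{coiso}}\mathbb{D}_Q=\{\lambda\in\mathbb{C}^d:Q(\lambda)Q(\lambda)^*=I_{\mathbb{C}^s}\}$. For $T\in\mathcal{B}(\mathbb{C}^r\otimes\mathcal{H},\mathbb{C}^s\otimes\mathcal{H})$, $\sigma_{ap}^Q(T)$ is the set of $\lambda\in\mathbb{C}^d$ for which there is a sequence of unit vectors $v_k\in\mathbb{C}^r\otimes\mathcal{H}$ with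 $\lim_{k\to\infty}\|Tv_k-(Q(\lambda)\otimes I_{\mathcal{H}})v_k\|=0$. *)

theory Defs
  imports "HOL-Analysis.Analysis"
begin

section \<open>Complex Hilbert spaces\<close>

text \<open>
  The real inner product of \<^class>\<open>real_inner\<close> is the real part of the complex one, so norm,
  topology and completeness are those of the complex Hilbert space.
  The inner product is linear in its first argument.
\<close>

class chilbert_space = real_inner + complete_space +
  fixes scaleC :: "complex \<Rightarrow> 'a \<Rightarrow> 'a" (infixr \<open>*\<^sub>C\<close> 75)
    and cinner :: "'a \<Rightarrow> 'a \<Rightarrow> complex"
  assumes scaleC_add_right: "a *\<^sub>C (x + y) = a *\<^sub>C x + a *\<^sub>C y"
    and scaleC_add_left: "(a + b) *\<^sub>C x = a *\<^sub>C x + b *\<^sub>C x"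
    and scaleC_scaleC: "a *\<^sub>C (b *\<^sub>C x) = (a * b) *\<^sub>C x"
    and scaleR_scaleC: "r *\<^sub>R x = complex_of_real r *\<^sub>C x"
    and cinner_commute: "cinner x y = cnj (cinner y x)"
    and cinner_add_left: "cinner (x + y) z = cinner x z + cinner y z"
    and cinner_scaleC_left: "cinner (a *\<^sub>C x) y = a * cinner x y"
    and inner_Re_cinner: "inner x y = Re (cinner x y)"

instantiation complex :: chilbert_space
begin

definition scaleC_complex :: "complex \<Rightarrow> complex \<Rightarrow> complex" where
  "scaleC_complex a x = a * x"

definition cinner_complex :: "complex \<Rightarrow> complex \<Rightarrow> complex" where
  "cinner_complex x y = x * cnj y"

instance
  by standard
    (auto simp: scaleC_complex_def cinner_complex_def algebra_simps inner_complex_def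
      scaleR_conv_of_real)

end

instantiation vec :: (chilbert_space, finite) chilbert_space
begin

definition scaleC_vec :: "complex \<Rightarrow> 'a ^ 'b \<Rightarrow> 'a ^ 'b" where
  "scaleC_vec a x = (\<chi> i. a *\<^sub>C (x $ i))"

definition cinner_vec :: "'a ^ 'b \<Rightarrow> 'a ^ 'b \<Rightarrow> complex" where
  "cinner_vec x y = (\<Sum>i\<in>UNIV. cinner (x $ i) (y $ i))"

instance
proof
  fix x y :: "'a ^ 'b"
  show "cinner x y = cnj (cinner y x)"
    unfolding cinner_vec_def cnj_sum by (rule sum.cong[OF refl], rule cinner_commute)
qed (auto simp: scaleC_vec_def cinner_vec_def vec_eq_iff scaleC_add_right scaleC_add_left
      scaleC_scaleC scaleR_scaleC cinner_add_left cinner_scaleC_left sum.distrib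
      sum_distrib_left inner_vec_def inner_Re_cinner)

end

instantiation prod :: (chilbert_space, chilbert_space) chilbert_space
begin

definition scaleC_prod :: "complex \<Rightarrow> 'a \<times> 'b \<Rightarrow> 'a \<times> 'b" where
  "scaleC_prod a x = (a *\<^sub>C fst x, a *\<^sub>C snd x)"

definition cinner_prod :: "'a \<times> 'b \<Rightarrow> 'a \<times> 'b \<Rightarrow> complex" where
  "cinner_prod x y = cinner (fst x) (fst y) + cinner (snd x) (snd y)"

instance
proof
  fix x y :: "'a \<times> 'b"
  show "cinner x y = cnj (cinner y x)"
    unfolding cinner_prod_def complex_cnj_add
    by (simp add: cinner_commute[symmetric])
qed (auto simp: scaleC_prod_def cinner_prod_def prod_eq_iff scaleC_add_right scaleC_add_left
      scaleC_scaleC scaleR_scaleC cinner_add_left cinner_scaleC_left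
      distrib_left inner_prod_def inner_Re_cinner)

end


section \<open>The Hilbert space of square-summable sequences\<close>

typedef ell2 = "{f :: nat \<Rightarrow> complex. summable (\<lambda>n. (cmod (f n))\<^sup>2)}"
  morphisms ell2_coord Abs_ell2
  by (rule exI[of _ "\<lambda>_. 0"]) simp

lemma ell2_summable: "summable (\<lambda>n. (cmod (ell2_coord f n))\<^sup>2)"
  using ell2_coord[of f] by simp

lemma ell2_coord_Abs:
  "summable (\<lambda>n. (cmod (f n))\<^sup>2) \<Longrightarrow> ell2_coord (Abs_ell2 f) = f"
  by (simp add: Abs_ell2_inverse)

lemma ell2_eq_iff: "f = g \<longleftrightarrow> (\<forall>n. ell2_coord f n = ell2_coord g n)"
  by (metis ell2_coord_inject ext)

lemma sq_summable_add:
  fixes f g :: "nat \<Rightarrow> complex"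
  assumes "summable (\<lambda>n. (cmod (f n))\<^sup>2)" "summable (\<lambda>n. (cmod (g n))\<^sup>2)"
  shows "summable (\<lambda>n. (cmod (f n + g n))\<^sup>2)"
proof (rule summable_comparison_test')
  show "summable (\<lambda>n. 2 * (cmod (f n))\<^sup>2 + 2 * (cmod (g n))\<^sup>2)"
    using assms by (intro summable_add summable_mult)
  fix n
  have "(cmod (f n + g n))\<^sup>2 \<le> (cmod (f n) + cmod (g n))\<^sup>2"
    by (simp add: norm_triangle_ineq power_mono)
  also have "\<dots> \<le> 2 * (cmod (f n))\<^sup>2 + 2 * (cmod (g n))\<^sup>2"
    using sum_squares_bound[of "cmod (f n)" "cmod (g n)"] by (simp add: power2_sum)
  finally show "norm ((cmod (f n + g n))\<^sup>2) \<le> 2 * (cmod (f n))\<^sup>2 + 2 * (cmod (g n))\<^sup>2"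
    by simp
qed

lemma sq_summable_mult:
  fixes f :: "nat \<Rightarrow> complex"
  assumes "summable (\<lambda>n. (cmod (f n))\<^sup>2)"
  shows "summable (\<lambda>n. (cmod (a * f n))\<^sup>2)"
  using summable_mult[OF assms, of "(cmod a)\<^sup>2"] by (simp add: norm_mult power_mult_distrib)

lemma sq_summable_diff:
  fixes f g :: "nat \<Rightarrow> complex"
  assumes "summable (\<lambda>n. (cmod (f n))\<^sup>2)" "summable (\<lambda>n. (cmod (g n))\<^sup>2)"
  shows "summable (\<lambda>n. (cmod (f n - g n))\<^sup>2)"
  using sq_summable_add[OF assms(1) sq_summable_mult[OF assms(2), of "-1"]] by simp

lemma ell2_summable_product: "summable (\<lambda>n. ell2_coord f n * cnj (ell2_coord g n))"
proof (rule summable_comparison_test')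
  show "summable (\<lambda>n. (cmod (ell2_coord f n))\<^sup>2 + (cmod (ell2_coord g n))\<^sup>2)"
    by (intro summable_add ell2_summable)
  fix n
  have "2 * (cmod (ell2_coord f n) * cmod (ell2_coord g n))
      \<le> (cmod (ell2_coord f n))\<^sup>2 + (cmod (ell2_coord g n))\<^sup>2"
    using sum_squares_bound[of "cmod (ell2_coord f n)" "cmod (ell2_coord g n)"] by simp
  moreover have "0 \<le> cmod (ell2_coord f n) * cmod (ell2_coord g n)"
    by simp
  ultimately show "norm (ell2_coord f n * cnj (ell2_coord g n))
      \<le> (cmod (ell2_coord f n))\<^sup>2 + (cmod (ell2_coord g n))\<^sup>2"
    unfolding norm_mult complex_mod_cnj by linarith
qed

instantiation ell2 :: real_vector
begin

definition "0 = Abs_ell2 (\<lambda>_. 0)"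
definition "f + g = Abs_ell2 (\<lambda>n. ell2_coord f n + ell2_coord g n)"
definition "f - g = Abs_ell2 (\<lambda>n. ell2_coord f n - ell2_coord g n)"
definition "- f = Abs_ell2 (\<lambda>n. - ell2_coord f n)"
definition "r *\<^sub>R f = Abs_ell2 (\<lambda>n. complex_of_real r * ell2_coord f n)"

lemma ell2_coord_zero: "ell2_coord 0 n = 0"
  by (simp add: zero_ell2_def ell2_coord_Abs)

lemma ell2_coord_add: "ell2_coord (f + g) n = ell2_coord f n + ell2_coord g n"
  by (simp add: plus_ell2_def ell2_coord_Abs sq_summable_add ell2_summable)

lemma ell2_coord_diff: "ell2_coord (f - g) n = ell2_coord f n - ell2_coord g n"
  by (simp add: minus_ell2_def ell2_coord_Abs sq_summable_diff ell2_summable)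

lemma ell2_coord_minus: "ell2_coord (- f) n = - ell2_coord f n"
  by (simp add: uminus_ell2_def ell2_coord_Abs ell2_summable)

lemma ell2_coord_scaleR: "ell2_coord (r *\<^sub>R f) n = complex_of_real r * ell2_coord f n"
  unfolding scaleR_ell2_def by (subst ell2_coord_Abs[OF sq_summable_mult[OF ell2_summable]]) simp

instance
  by standard (simp_all add: ell2_eq_iff ell2_coord_zero ell2_coord_add ell2_coord_diff
      ell2_coord_minus ell2_coord_scaleR algebra_simps)

end

instantiation ell2 :: real_inner
begin

definition inner_ell2 :: "ell2 \<Rightarrow> ell2 \<Rightarrow> real" where
  "inner_ell2 f g = Re (\<Sum>n. ell2_coord f n * cnj (ell2_coord g n))"
definition norm_ell2 :: "ell2 \<Rightarrow> real" where
  "norm_ell2 f = sqrt (inner f f)"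
definition dist_ell2 :: "ell2 \<Rightarrow> ell2 \<Rightarrow> real" where
  "dist_ell2 f g = norm (f - g)"
definition sgn_ell2 :: "ell2 \<Rightarrow> ell2" where
  "sgn_ell2 f = f /\<^sub>R norm f"
definition uniformity_ell2 :: "(ell2 \<times> ell2) filter" where
  "uniformity_ell2 = (INF e\<in>{0<..}. principal {(f, g). dist f g < e})"
definition open_ell2 :: "ell2 set \<Rightarrow> bool" where
  "open_ell2 U \<longleftrightarrow> (\<forall>f\<in>U. \<forall>\<^sub>F (f', g) in uniformity. f' = f \<longrightarrow> g \<in> U)"

lemma inner_ell2_eq: "inner f g = (\<Sum>n. Re (ell2_coord f n * cnj (ell2_coord g n)))"
  unfolding inner_ell2_def by (rule bounded_linear.suminf[OF bounded_linear_Re ell2_summable_product])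

lemma inner_ell2_self: "inner f f = (\<Sum>n. (cmod (ell2_coord f n))\<^sup>2)" for f :: ell2
  unfolding inner_ell2_eq by (simp only: complex_norm_square[symmetric] Re_complex_of_real)

instance
proof
  fix f g h :: ell2 and r :: real
  show "dist f g = norm (f - g)" by (rule dist_ell2_def)
  show "sgn f = f /\<^sub>R norm f" by (rule sgn_ell2_def)
  show "uniformity = (INF e\<in>{0<..}. principal {(x :: ell2, y). dist x y < e})"
    by (rule uniformity_ell2_def)
  show "open U = (\<forall>x\<in>U. \<forall>\<^sub>F (x', y) in uniformity. x' = x \<longrightarrow> y \<in> U)" for U :: "ell2 set"
    by (rule open_ell2_def)
  show "inner f g = inner g f"
    by (simp add: inner_ell2_eq algebra_simps)
  show "inner (f + g) h = inner f h + inner g h"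
    unfolding inner_ell2_def ell2_coord_add distrib_right plus_complex.sel(1)[symmetric]
    by (rule arg_cong[where f = Re],
        rule suminf_add[OF ell2_summable_product ell2_summable_product, symmetric])
  show "inner (r *\<^sub>R f) g = r * inner f g"
    unfolding inner_ell2_def ell2_coord_scaleR mult.assoc
    by (subst suminf_mult[OF ell2_summable_product]) simp
  show "0 \<le> inner f f"
    unfolding inner_ell2_self by (intro suminf_nonneg ell2_summable) simp
  show "inner f f = 0 \<longleftrightarrow> f = 0"
    unfolding inner_ell2_self
    by (subst suminf_eq_zero_iff[OF ell2_summable]) (auto simp: ell2_eq_iff ell2_coord_zero)
  show "norm f = sqrt (inner f f)" by (rule norm_ell2_def)
qed

end

lemma ell2_norm_sq: "(norm f)\<^sup>2 = (\<Sum>n. (cmod (ell2_coord f n))\<^sup>2)"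
  by (metis dot_square_norm inner_ell2_self)

lemma ell2_partial_sum_le: "(\<Sum>n<N. (cmod (ell2_coord f n))\<^sup>2) \<le> (norm f)\<^sup>2"
  unfolding ell2_norm_sq by (intro sum_le_suminf ell2_summable) auto

lemma ell2_coord_le: "cmod (ell2_coord f n) \<le> norm f"
proof -
  have "(cmod (ell2_coord f n))\<^sup>2 \<le> (\<Sum>k<Suc n. (cmod (ell2_coord f k))\<^sup>2)"
    by (simp add: sum_nonneg)
  also have "\<dots> \<le> (norm f)\<^sup>2" by (rule ell2_partial_sum_le)
  finally show ?thesis by (rule power2_le_imp_le) simp
qed

instance ell2 :: complete_space
proof
  fix X :: "nat \<Rightarrow> ell2"
  assume X: "Cauchy X"
  have "Cauchy (\<lambda>k. ell2_coord (X k) n)" for n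
  proof (rule metric_CauchyI)
    fix e :: real assume "e > 0"
    then obtain M where "\<forall>m\<ge>M. \<forall>k\<ge>M. dist (X m) (X k) < e"
      using metric_CauchyD[OF X] by blast
    then show "\<exists>M. \<forall>m\<ge>M. \<forall>k\<ge>M. dist (ell2_coord (X m) n) (ell2_coord (X k) n) < e"
      unfolding dist_norm by (metis ell2_coord_diff ell2_coord_le order_le_less_trans)
  qed
  then have "\<exists>l. (\<lambda>k. ell2_coord (X k) n) \<longlonglongrightarrow> l" for n
    by (simp add: Cauchy_convergent_iff convergent_def)
  then obtain a where a: "\<And>n. (\<lambda>k. ell2_coord (X k) n) \<longlonglongrightarrow> a n"
    by metis
  have tail: "\<exists>M. \<forall>m\<ge>M. \<forall>N. (\<Sum>n<N. (cmod (ell2_coord (X m) n - a n))\<^sup>2) \<le> e\<^sup>2"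
    if e: "e > 0" for e :: real
  proof -
    obtain M where M: "\<And>m k. m \<ge> M \<Longrightarrow> k \<ge> M \<Longrightarrow> norm (X m - X k) < e"
      using metric_CauchyD[OF X e] by (auto simp: dist_norm)
    have "(\<Sum>n<N. (cmod (ell2_coord (X m) n - a n))\<^sup>2) \<le> e\<^sup>2" if "m \<ge> M" for m N
    proof (rule tendsto_upperbound)
      show "(\<lambda>k. \<Sum>n<N. (cmod (ell2_coord (X m) n - ell2_coord (X k) n))\<^sup>2)
          \<longlonglongrightarrow> (\<Sum>n<N. (cmod (ell2_coord (X m) n - a n))\<^sup>2)"
        by (intro tendsto_intros a)
      show "\<forall>\<^sub>F k in sequentially.
          (\<Sum>n<N. (cmod (ell2_coord (X m) n - ell2_coord (X k) n))\<^sup>2) \<le> e\<^sup>2"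
        unfolding eventually_sequentially
      proof (intro exI[of _ M] allI impI)
        fix k assume "k \<ge> M"
        have "(\<Sum>n<N. (cmod (ell2_coord (X m) n - ell2_coord (X k) n))\<^sup>2) \<le> (norm (X m - X k))\<^sup>2"
          using ell2_partial_sum_le[of "X m - X k" N] by (simp add: ell2_coord_diff)
        also have "\<dots> \<le> e\<^sup>2"
          using M[OF \<open>m \<ge> M\<close> \<open>k \<ge> M\<close>] by (intro power_mono) auto
        finally show "(\<Sum>n<N. (cmod (ell2_coord (X m) n - ell2_coord (X k) n))\<^sup>2) \<le> e\<^sup>2" .
      qed
    qed simp
    then show ?thesis by blast
  qed
  have sm: "summable (\<lambda>n. (cmod (ell2_coord (X m) n - a n))\<^sup>2)"
    if "\<forall>N. (\<Sum>n<N. (cmod (ell2_coord (X m) n - a n))\<^sup>2) \<le> e\<^sup>2" for m and e :: real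
    using that by (intro bounded_imp_summable[where B = "e\<^sup>2"])
      (auto simp flip: lessThan_Suc_atMost simp del: sum.lessThan_Suc)
  have a_sum: "summable (\<lambda>n. (cmod (a n))\<^sup>2)"
  proof -
    obtain M where "\<forall>N. (\<Sum>n<N. (cmod (ell2_coord (X M) n - a n))\<^sup>2) \<le> 1\<^sup>2"
      using tail[of 1] by auto
    from sq_summable_diff[OF ell2_summable[of "X M"] sm[OF this]] show ?thesis by simp
  qed
  have "X \<longlonglongrightarrow> Abs_ell2 a"
  proof (rule metric_LIMSEQ_I)
    fix e :: real assume "e > 0"
    then obtain M where M: "\<forall>m\<ge>M. \<forall>N. (\<Sum>n<N. (cmod (ell2_coord (X m) n - a n))\<^sup>2) \<le> (e/2)\<^sup>2"
      using tail[of "e/2"] by auto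
    have "dist (X m) (Abs_ell2 a) < e" if "m \<ge> M" for m
    proof -
      have "(norm (X m - Abs_ell2 a))\<^sup>2 = (\<Sum>n. (cmod (ell2_coord (X m) n - a n))\<^sup>2)"
        by (simp add: ell2_norm_sq ell2_coord_diff ell2_coord_Abs[OF a_sum])
      also have "\<dots> \<le> (e/2)\<^sup>2"
        using M that by (intro suminf_le_const sm) auto
      finally have "norm (X m - Abs_ell2 a) \<le> e/2"
        by (rule power2_le_imp_le) (use \<open>e > 0\<close> in simp)
      then show ?thesis using \<open>e > 0\<close> by (simp add: dist_norm)
    qed
    then show "\<exists>M. \<forall>m\<ge>M. dist (X m) (Abs_ell2 a) < e" by blast
  qed
  then show "convergent X" by (rule convergentI)
qed

instantiation ell2 :: chilbert_space
begin

definition scaleC_ell2 :: "complex \<Rightarrow> ell2 \<Rightarrow> ell2" where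
  "scaleC_ell2 a f = Abs_ell2 (\<lambda>n. a * ell2_coord f n)"

definition cinner_ell2 :: "ell2 \<Rightarrow> ell2 \<Rightarrow> complex" where
  "cinner_ell2 f g = (\<Sum>n. ell2_coord f n * cnj (ell2_coord g n))"

lemma ell2_coord_scaleC: "ell2_coord (a *\<^sub>C f) n = a * ell2_coord f n"
  unfolding scaleC_ell2_def by (subst ell2_coord_Abs[OF sq_summable_mult[OF ell2_summable]]) simp

instance
proof
  fix f g h :: ell2 and a b :: complex
  show "cinner f g = cnj (cinner g f)"
  proof -
    have "(\<lambda>n. cnj (ell2_coord g n * cnj (ell2_coord f n))) sums cnj (cinner g f)"
      unfolding sums_cnj cinner_ell2_def
      by (rule summable_sums[OF ell2_summable_product])
    then show ?thesis
      by (simp add: cinner_ell2_def sums_iff mult.commute)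
  qed
  show "cinner (f + g) h = cinner f h + cinner g h"
    using suminf_add[OF ell2_summable_product[of f h] ell2_summable_product[of g h]]
    by (simp add: cinner_ell2_def ell2_coord_add distrib_right)
  show "cinner (a *\<^sub>C f) g = a * cinner f g"
    using suminf_mult[OF ell2_summable_product[of f g], of a]
    by (simp add: cinner_ell2_def ell2_coord_scaleC mult.assoc)
  show "inner f g = Re (cinner f g)"
    by (simp add: inner_ell2_def cinner_ell2_def)
qed (simp_all add: ell2_eq_iff ell2_coord_add ell2_coord_scaleR ell2_coord_scaleC algebra_simps)

end


section \<open>Bounded operators\<close>

definition bounded_clinear :: "('a::chilbert_space \<Rightarrow> 'b::chilbert_space) \<Rightarrow> bool" where
  "bounded_clinear T \<longleftrightarrow> bounded_linear T \<and> (\<forall>c x. T (c *\<^sub>C x) = c *\<^sub>C T x)"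

definition cadjoint ::
    "('a::chilbert_space \<Rightarrow> 'b::chilbert_space) \<Rightarrow> 'b \<Rightarrow> 'a" where
  "cadjoint T = (THE S. \<forall>x y. cinner (T x) y = cinner x (S y))"

definition unitary_operator :: "('a::chilbert_space \<Rightarrow> 'b::chilbert_space) \<Rightarrow> bool" where
  "unitary_operator V \<longleftrightarrow>
    bounded_clinear V \<and> surj V \<and> (\<forall>x y. cinner (V x) (V y) = cinner x y)"

definition block_operator ::
    "('a \<Rightarrow> 'c) \<Rightarrow> ('b \<Rightarrow> 'c) \<Rightarrow> ('a \<Rightarrow> 'e) \<Rightarrow> ('b \<Rightarrow> 'e) \<Rightarrow>
      'a::chilbert_space \<times> 'b::chilbert_space \<Rightarrow> 'c::chilbert_space \<times> 'e::chilbert_space" where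
  "block_operator A B C D = (\<lambda>(x, y). (A x + B y, C x + D y))"


section \<open>Linear pencils and the matrix unit ball\<close>

text \<open>
  A pencil is given by its coefficient matrices, \<^term>\<open>Q j\<close> being an \<open>s \<times> r\<close> matrix for each
  \<open>j\<close>; the sizes \<open>d\<close>, \<open>r\<close>, \<open>s\<close> are the cardinalities of the finite index types.
\<close>

definition pencil :: "('d::finite \<Rightarrow> complex ^ 'r ^ 's) \<Rightarrow> complex ^ 'd \<Rightarrow> complex ^ 'r ^ 's" where
  "pencil Q z = (\<Sum>j\<in>UNIV. (z $ j) *\<^sub>C Q j)"

definition matrix_norm :: "complex ^ 'r ^ 's \<Rightarrow> real" where
  "matrix_norm M = onorm ((*v) M)"

definition matrix_ball :: "('d::finite \<Rightarrow> complex ^ 'r ^ 's) \<Rightarrow> (complex ^ 'd) set" where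
  "matrix_ball Q = {z. matrix_norm (pencil Q z) < 1}"

definition matrix_sphere :: "('d::finite \<Rightarrow> complex ^ 'r ^ 's) \<Rightarrow> (complex ^ 'd) set" where
  "matrix_sphere Q = {z. matrix_norm (pencil Q z) = 1}"

definition conj_transpose :: "complex ^ 'r ^ 's \<Rightarrow> complex ^ 's ^ 'r" where
  "conj_transpose M = transpose (map_matrix cnj M)"

definition iso_boundary :: "('d::finite \<Rightarrow> complex ^ 'r ^ 's) \<Rightarrow> (complex ^ 'd) set" where
  "iso_boundary Q = {z. conj_transpose (pencil Q z) ** pencil Q z = mat 1}"

definition coiso_boundary :: "('d::finite \<Rightarrow> complex ^ 'r ^ 's) \<Rightarrow> (complex ^ 'd) set" where
  "coiso_boundary Q = {z. pencil Q z ** conj_transpose (pencil Q z) = mat 1}"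

definition essential_boundary :: "('d::finite \<Rightarrow> complex ^ 'r ^ 's) \<Rightarrow> (complex ^ 'd) set" where
  "essential_boundary Q = iso_boundary Q \<union> coiso_boundary Q"

text \<open>
  The Hilbert space tensor product of \<open>\<complex>\<^sup>r\<close> with \<open>H\<close> is the space of \<open>r\<close>-tuples of vectors of
  \<open>H\<close>, with the \<open>\<ell>\<^sup>2\<close>-sum norm. The operator \<^term>\<open>ampliation M\<close> is then the tensor product of
  the matrix \<open>M\<close> with the identity of \<open>H\<close>.
\<close>

definition ampliation :: "complex ^ 'r ^ 's \<Rightarrow> 'h::chilbert_space ^ 'r \<Rightarrow> 'h ^ 's" where
  "ampliation M v = (\<chi> i. \<Sum>k\<in>UNIV. (M $ i $ k) *\<^sub>C (v $ k))"

definition approx_spectrum ::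
    "('d::finite \<Rightarrow> complex ^ 'r ^ 's) \<Rightarrow> ('h::chilbert_space ^ 'r \<Rightarrow> 'h ^ 's) \<Rightarrow>
      (complex ^ 'd) set" where
  "approx_spectrum Q T =
    {z. \<exists>v :: nat \<Rightarrow> 'h ^ 'r. (\<forall>k. norm (v k) = 1) \<and>
          (\<lambda>k. norm (T (v k) - ampliation (pencil Q z) (v k))) \<longlonglongrightarrow> 0}"


section \<open>The Schur--Agler class\<close>

definition holomorphic_several :: "(complex ^ 'd::finite \<Rightarrow> complex) \<Rightarrow> (complex ^ 'd) set \<Rightarrow> bool" where
  "holomorphic_several f U \<longleftrightarrow>
    (\<forall>z\<in>U. \<exists>L. (f has_derivative L) (at z) \<and> (\<forall>c w. L (c *\<^sub>C w) = c * L w))"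

definition taylor_coeffs :: "(complex ^ 'd::finite \<Rightarrow> complex) \<Rightarrow> ('d \<Rightarrow> nat) \<Rightarrow> complex" where
  "taylor_coeffs f = (THE c. \<exists>e>0. \<forall>z. norm z < e \<longrightarrow>
     ((\<lambda>\<alpha>. c \<alpha> * (\<Prod>j\<in>UNIV. (z $ j) ^ \<alpha> j)) has_sum f z) UNIV)"

definition operator_monomial :: "('d::finite \<Rightarrow> 'k \<Rightarrow> 'k) \<Rightarrow> ('d \<Rightarrow> nat) \<Rightarrow> 'k \<Rightarrow> 'k" where
  "operator_monomial T \<alpha> = Finite_Set.fold (\<lambda>j S. (T j ^^ \<alpha> j) \<circ> S) id UNIV"

text \<open>
  The value \<open>f(T)\<close> of the holomorphic functional calculus. A matrix unit ball is a balanced domain,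
  so the expansion of \<open>f\<close> into homogeneous polynomials converges to \<open>f\<close> uniformly on compact subsets
  of the ball. For commuting \<open>T\<close> with \<open>\<parallel>Q(T)\<parallel> < 1\<close> the joint spectrum of \<open>T\<close> lies in the ball, and
  by continuity of the calculus \<open>f(T)\<close> is the sum of the homogeneous polynomials evaluated at \<open>T\<close>.
\<close>

definition functional_calculus ::
    "(complex ^ 'd::finite \<Rightarrow> complex) \<Rightarrow> ('d \<Rightarrow> 'k \<Rightarrow> 'k) \<Rightarrow> 'k::chilbert_space \<Rightarrow> 'k" where
  "functional_calculus f T x =
    (\<Sum>n. \<Sum>\<alpha> | (\<Sum>j\<in>UNIV. \<alpha> j) = n. taylor_coeffs f \<alpha> *\<^sub>C operator_monomial T \<alpha> x)"

definition operator_pencil ::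
    "('d::finite \<Rightarrow> complex ^ 'r ^ 's) \<Rightarrow> ('d \<Rightarrow> 'k \<Rightarrow> 'k) \<Rightarrow> 'k::chilbert_space ^ 'r \<Rightarrow> 'k ^ 's" where
  "operator_pencil Q T v = (\<Sum>j\<in>UNIV. ampliation (Q j) (\<chi> k. T j (v $ k)))"

text \<open>
  The tuples range over the operators on the infinite-dimensional separable space \<^typ>\<open>ell2\<close>, as HOL
  cannot quantify over all Hilbert spaces inside a formula. This defines the same class: a tuple on
  a separable space \<open>K\<close> is, up to unitary equivalence, a direct summand of the tuple on \<open>\<ell>\<^sup>2\<close> obtained
  by adding zero operators, \<open>f(T)\<close> and \<open>\<parallel>Q(T)\<parallel>\<close> are compatible with direct sums, and on a general
  \<open>K\<close> the norm of \<open>f(T)\<close> is attained as a supremum over separable reducing subspaces.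
\<close>

definition schur_agler ::
    "('d::finite \<Rightarrow> complex ^ 'r ^ 's) \<Rightarrow> (complex ^ 'd \<Rightarrow> complex) set" where
  "schur_agler Q = {f. holomorphic_several f (matrix_ball Q) \<and>
     (\<forall>T :: 'd \<Rightarrow> ell2 \<Rightarrow> ell2.
        (\<forall>j. bounded_clinear (T j)) \<longrightarrow> (\<forall>i j. T i \<circ> T j = T j \<circ> T i) \<longrightarrow>
        onorm (operator_pencil Q T) < 1 \<longrightarrow> onorm (functional_calculus f T) \<le> 1)}"


section \<open>Boundary points\<close>

definition radial_limit :: "(complex ^ 'd::finite \<Rightarrow> complex) \<Rightarrow> complex ^ 'd \<Rightarrow> complex" where
  "radial_limit f z = Lim (at_left 1) (\<lambda>t :: real. f (t *\<^sub>R z))"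

definition BP ::
    "('d::finite \<Rightarrow> complex ^ 'r ^ 's) \<Rightarrow> (complex ^ 'd \<Rightarrow> complex) \<Rightarrow> (complex ^ 'd) set" where
  "BP Q f = {z \<in> matrix_sphere Q. \<exists>l. ((\<lambda>t :: real. f (t *\<^sub>R z)) \<longlongrightarrow> l) (at_left 1)}"

definition BP_one ::
    "('d::finite \<Rightarrow> complex ^ 'r ^ 's) \<Rightarrow> (complex ^ 'd \<Rightarrow> complex) \<Rightarrow> (complex ^ 'd) set" where
  "BP_one Q f = {z \<in> BP Q f. cmod (radial_limit f z) < 1}"

end

theory Submission
  imports Defs
begin

text \<open>
  Fix \<open>\<lambda>\<close> in the essential boundary and write \<open>M\<close> for the ampliation of \<open>Q(\<lambda>)\<close> and \<open>M\<^sup>*\<close> for its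
  adjoint, so that the ampliation of \<open>Q(t\<lambda>)\<close> is \<open>tM\<close>. For \<open>0 \<le> t < 1\<close> the equation
  \<open>x = tM(Dx + C1)\<close> has a unique solution because \<open>tMD\<close> is a strict contraction, and with
  \<open>y = Dx + C1\<close> the realization says that \<open>V(1, tMy) = (f(t\<lambda>), y)\<close>.

  In the isometric case take \<open>v = y\<close>. Since \<open>V\<close> and \<open>M\<close> preserve norms,
  \<open>1 + t\<^sup>2\<parallel>v\<parallel>\<^sup>2 = |f(t\<lambda>)|\<^sup>2 + \<parallel>v\<parallel>\<^sup>2\<close>, and the second component of \<open>V\<^sup>*(f(t\<lambda>), y) = (1, tMy)\<close> shows
  that \<open>D\<^sup>*v - Mv\<close> is bounded by \<open>(1 - t)\<parallel>v\<parallel> + 1\<close>.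

  In the coisometric case \<open>M\<close> may have a kernel, so \<open>y\<close> may stay bounded. The same argument then
  applies to \<open>V\<^sup>*\<close> and the isometry \<open>M\<^sup>*\<close>: solve \<open>u = B\<^sup>*1 + tD\<^sup>*M\<^sup>*u\<close>, so that
  \<open>V\<^sup>*(1, tM\<^sup>*u) = (c, u)\<close> for some \<open>c\<close>. Pairing this relation with the one for \<open>V\<close> gives
  \<open>c = cnj (f(t\<lambda>))\<close>, and \<open>v = M\<^sup>*u\<close> satisfies the same two relations as in the isometric case.

  So in both cases \<open>\<parallel>v\<parallel>\<^sup>2 = (1 - |f(t\<lambda>)|\<^sup>2) / (1 - t\<^sup>2)\<close>. If the radial limit of \<open>f\<close> at \<open>\<lambda>\<close> has modulus
  less than \<open>1\<close>, this tends to infinity as \<open>t\<close> tends to \<open>1\<close>, while the error \<open>D\<^sup>*v - Mv\<close> is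
  negligible against \<open>\<parallel>v\<parallel>\<close>. The normalized vectors \<open>v\<close> are therefore approximate eigenvectors.

  The two cases are \<open>isometric_eigenvector\<close> and \<open>coisometric_eigenvector\<close>; the lemma
  \<open>realization_approximate_eigenvector\<close> applies them to the realization of \<open>f\<close>.
\<close>

section \<open>Elementary Hilbert space facts\<close>

lemma cinner_add_right: "cinner x (y + z) = cinner x y + cinner x z"
  by (metis cinner_add_left cinner_commute complex_cnj_add)

lemma cinner_scaleC_right: "cinner x (a *\<^sub>C y) = cnj a * cinner x y"
  by (metis cinner_commute cinner_scaleC_left complex_cnj_mult)

lemma cinner_scaleR_left: "cinner (r *\<^sub>R x) y = of_real r * cinner x y"
  by (simp add: scaleR_scaleC cinner_scaleC_left)

lemma cinner_scaleR_right: "cinner x (r *\<^sub>R y) = of_real r * cinner x y"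
  by (simp add: scaleR_scaleC cinner_scaleC_right)

lemma cinner_minus_right: "cinner x (- y) = - cinner x y"
  using cinner_scaleR_right[of x "-1" y] by simp

lemma cinner_diff_right: "cinner x (y - z) = cinner x y - cinner x z"
  using cinner_add_right[of x y "- z"] by (simp add: cinner_minus_right)

lemma cinner_zero_left [simp]: "cinner 0 x = 0"
  using cinner_scaleR_left[of 0 x x] by simp

lemma cinner_zero_right [simp]: "cinner x 0 = 0"
  using cinner_scaleR_right[of x 0 x] by simp

lemma scaleC_zero_left [simp]: "0 *\<^sub>C x = 0"
  using scaleC_add_left[of 0 0 x] by simp

lemma scaleC_one [simp]: "1 *\<^sub>C x = x"
  using scaleR_scaleC[of 1 x] by simp

lemma scaleC_zero_right [simp]: "a *\<^sub>C 0 = 0"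
  using scaleC_add_right[of a 0 0] by simp

lemma scaleC_sum_right: "a *\<^sub>C sum f S = (\<Sum>i\<in>S. a *\<^sub>C f i)"
  by (induction S rule: infinite_finite_induct) (simp_all add: scaleC_add_right)

lemma scaleC_sum_left: "sum f S *\<^sub>C x = (\<Sum>i\<in>S. f i *\<^sub>C x)"
  by (induction S rule: infinite_finite_induct) (simp_all add: scaleC_add_left)

lemma cinner_sum_left: "cinner (sum f S) y = (\<Sum>i\<in>S. cinner (f i) y)"
  by (induction S rule: infinite_finite_induct) (simp_all add: cinner_add_left)

lemma cinner_sum_right: "cinner x (sum f S) = (\<Sum>i\<in>S. cinner x (f i))"
  by (induction S rule: infinite_finite_induct) (simp_all add: cinner_add_right)

lemma norm_eq_if_cinner_eq: "cinner x x = cinner y y \<Longrightarrow> norm x = norm y"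
  by (simp add: norm_eq_sqrt_inner inner_Re_cinner)

lemma norm_snd_le_norm: "norm (snd p) \<le> norm p"
  by (metis norm_snd_le prod.collapse)

lemma cinner_ext:
  assumes "\<And>x. cinner x y = cinner x z"
  shows "y = z"
proof -
  have "inner (y - z) (y - z) = 0"
    by (simp add: inner_Re_cinner cinner_diff_right assms)
  then show ?thesis by simp
qed

lemma cadjoint_eqI:
  assumes "\<And>x y. cinner (T x) y = cinner x (S y)"
  shows "cadjoint T = S"
  unfolding cadjoint_def
proof (rule the_equality)
  show "\<forall>x y. cinner (T x) y = cinner x (S y)" using assms by blast
  fix S' assume "\<forall>x y. cinner (T x) y = cinner x (S' y)"
  then show "S' = S" by (metis assms cinner_ext ext)
qed

text \<open>
  Here \<open>N\<close> is the adjoint of \<open>M\<close>. For an isometric \<open>N\<close> the contractivity of \<open>M\<close> comes from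
  \<open>\<parallel>Mv\<parallel>\<^sup>2 = \<langle>v, NMv\<rangle> \<le> \<parallel>v\<parallel> \<parallel>Mv\<parallel>\<close>. At points of the coisometric
  boundary this makes the ampliation of the pencil a contraction.
\<close>

lemma norm_le_if_adjoint_isometric:
  assumes adj: "\<And>v w. cinner (M v) w = cinner v (N w)"
    and iso: "\<And>w. norm (N w) = norm w"
  shows "norm (M v) \<le> norm v"
proof -
  have "norm (M v) * norm (M v) = inner v (N (M v))"
    by (metis adj inner_Re_cinner norm_eq_square power2_eq_square)
  also have "\<dots> \<le> norm v * norm (M v)"
    using norm_cauchy_schwarz[of v "N (M v)"] by (simp add: iso)
  finally show ?thesis
    by (metis mult_right_le_imp_le norm_ge_zero order_le_less)
qed

text \<open>
  This is the surjectivity of \<open>I - K\<close>. The iteration in Banach's fixed point theorem, started at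
  \<open>0\<close>, produces the partial sums of the Neumann series for \<open>(I - K)\<^sup>-\<^sup>1 b\<close>.
\<close>

lemma affine_contraction_fixpoint:
  fixes K :: "'a :: {real_normed_vector, complete_space} \<Rightarrow> 'a"
  assumes "linear K" "c < 1" "\<And>x. norm (K x) \<le> c * norm x"
  shows "\<exists>x. x = b + K x"
proof -
  have "\<exists>!x. b + K x = x"
  proof (rule banach_fix_type)
    show "0 \<le> max c 0" "max c 0 < 1" using assms by auto
    show "\<forall>x y. dist (b + K x) (b + K y) \<le> max c 0 * dist x y"
    proof (intro allI)
      fix x y
      have "dist (b + K x) (b + K y) = norm (K (x - y))"
        by (simp add: dist_norm linear_diff[OF assms(1)])
      also have "\<dots> \<le> c * norm (x - y)" by (rule assms)
      also have "\<dots> \<le> max c 0 * dist x y" by (simp add: dist_norm mult_right_mono)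
      finally show "dist (b + K x) (b + K y) \<le> max c 0 * dist x y" .
    qed
  qed
  then show ?thesis by metis
qed

section \<open>Unitary operators\<close>

lemma unitary_inv:
  assumes "unitary_operator V"
  shows unitary_norm: "norm (V p) = norm p"
    and unitary_inv_left: "inv V (V p) = p"
    and unitary_inv_adjoint: "cinner (V p) q = cinner p (inv V q)"
    and unitary_inv_norm: "norm (inv V q) = norm q"
    and unitary_inv_linear: "linear (inv V)"
proof -
  have lin: "linear V"
    using assms unfolding unitary_operator_def bounded_clinear_def
    by (blast intro: bounded_linear.linear)
  show nrm: "norm (V p) = norm p" for p
    using assms unfolding unitary_operator_def by (blast intro: norm_eq_if_cinner_eq)
  have "inj V"
    unfolding linear_injective_0[OF lin] using nrm by (metis norm_eq_zero)
  then show "inv V (V p) = p" by simp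
  have right: "V (inv V q) = q" for q
    using assms unfolding unitary_operator_def by (blast intro: surj_f_inv_f)
  show "cinner (V p) q = cinner p (inv V q)"
    using assms right unfolding unitary_operator_def by metis
  show "norm (inv V q) = norm q" using nrm right by metis
  show "linear (inv V)"
    using lin \<open>inj V\<close> right by (metis (mono_tags) inj_eq linear_iff)
qed

lemma unitary_inv_corner_linear:
  fixes V :: "'a::chilbert_space \<times> 'e::chilbert_space \<Rightarrow> 'b::chilbert_space \<times> 'f::chilbert_space"
  assumes "unitary_operator V"
  shows "linear (\<lambda>y. snd (inv V (0, y)))"
proof -
  have "linear (\<lambda>y. (0 :: 'b, y :: 'f))" by (rule linearI) auto
  from linear_compose[OF linear_compose[OF this unitary_inv_linear[OF assms]] linear_snd]
  show ?thesis by (simp add: comp_def)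
qed

text \<open>
  For a corner of a unitary operator the adjoint can be read off from the inverse of the whole
  operator; in particular it exists.
\<close>

lemma cadjoint_block:
  assumes "linear A" "linear C" "unitary_operator (block_operator A B C D)"
  shows "cadjoint D = (\<lambda>y. snd (inv (block_operator A B C D) (0, y)))"
proof (rule cadjoint_eqI)
  fix x y
  let ?V = "block_operator A B C D"
  have "cinner (D x) y = cinner (?V (0, x)) (0, y)"
    using assms(1,2) by (simp add: block_operator_def cinner_prod_def linear_0)
  also have "\<dots> = cinner (0, x) (inv ?V (0, y))"
    by (rule unitary_inv_adjoint[OF assms(3)])
  finally show "cinner (D x) y = cinner x (snd (inv ?V (0, y)))"
    by (simp add: cinner_prod_def)
qed

section \<open>Ampliations\<close>

lemma linear_ampliation: "linear (ampliation M)"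
  by (rule linearI)
    (simp_all add: ampliation_def vec_eq_iff scaleC_add_right sum.distrib scaleR_sum_right
      scaleR_scaleC scaleC_vec_def scaleC_sum_right scaleC_scaleC mult.commute)

lemma ampliation_mult: "ampliation (M ** N) v = ampliation M (ampliation N v)"
  unfolding ampliation_def matrix_matrix_mult_def vec_eq_iff
  by (auto simp: scaleC_sum_left scaleC_sum_right scaleC_scaleC intro: sum.swap)

lemma ampliation_one: "ampliation (mat 1) v = v"
  by (simp add: ampliation_def mat_def vec_eq_iff if_distrib[of "\<lambda>c. c *\<^sub>C _"] sum.delta
      cong: if_cong)

lemma ampliation_adjoint:
  "cinner (ampliation M v) w = cinner v (ampliation (conj_transpose M) w)"
  unfolding ampliation_def cinner_vec_def conj_transpose_def
  by (simp add: cinner_sum_left cinner_sum_right cinner_scaleC_left cinner_scaleC_right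
      transpose_def map_matrix_def) (rule sum.swap)

lemma pencil_scaleR: "pencil Q (t *\<^sub>R z) = t *\<^sub>R pencil Q z"
  by (simp add: pencil_def scaleR_scaleC scaleC_sum_right scaleC_scaleC)
    (simp add: scaleC_vec_def scaleC_complex_def)

lemma ampliation_scaleR: "ampliation (t *\<^sub>R M) v = t *\<^sub>R ampliation M v"
  by (simp add: ampliation_def vec_eq_iff scaleR_scaleC scaleC_vec_def scaleC_complex_def
      scaleC_sum_right scaleC_scaleC)

lemma conj_transpose_twice: "conj_transpose (conj_transpose M) = M"
  by (simp add: conj_transpose_def transpose_def map_matrix_def vec_eq_iff)

lemma norm_ampliation_isometry:
  assumes "conj_transpose M ** M = mat 1"
  shows "norm (ampliation M v) = norm v"
proof (rule norm_eq_if_cinner_eq)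
  show "cinner (ampliation M v) (ampliation M v) = cinner v v"
    by (simp add: ampliation_adjoint ampliation_mult[symmetric] assms ampliation_one)
qed

lemma radial_in_matrix_ball:
  fixes Q :: "'d::finite \<Rightarrow> complex ^ 'r::finite ^ 's::finite"
  assumes "z \<in> matrix_sphere Q" "0 \<le> t" "t < 1"
  shows "t *\<^sub>R z \<in> matrix_ball Q"
proof -
  have "linear ((*v) (pencil Q z))"
    by (rule linearI) (simp_all add: matrix_vector_mult_def vec_eq_iff algebra_simps
        sum.distrib scaleR_sum_right)
  then have bl: "bounded_linear ((*v) (pencil Q z))"
    by (simp add: linear_conv_bounded_linear)
  have "(*v) (t *\<^sub>R pencil Q z) = (\<lambda>v. t *\<^sub>R (pencil Q z *v v))"
    by (auto simp: matrix_vector_mult_def vec_eq_iff scaleR_sum_right)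
  then have "matrix_norm (pencil Q (t *\<^sub>R z)) = t * matrix_norm (pencil Q z)"
    using onorm_scaleR[OF bl, of t] \<open>0 \<le> t\<close> by (simp add: matrix_norm_def pencil_scaleR)
  then show ?thesis using assms by (simp add: matrix_ball_def matrix_sphere_def)
qed

section \<open>Approximate eigenvectors\<close>

text \<open>
  For an isometry \<open>M\<close> the vector \<open>y\<close> itself is an approximate solution of \<open>D\<^sup>*y = My\<close>: as \<open>V\<^sup>*\<close>
  maps \<open>(a, y)\<close> to \<open>(1, tMy)\<close>, the error consists of \<open>(1 - t)My\<close> and the second component of
  \<open>V\<^sup>*(a, 0)\<close>. The norm identity is that of \<open>V\<close>, and it also yields \<open>|a| \<le> 1\<close>.
\<close>

lemma isometric_eigenvector:
  fixes M :: "'f::chilbert_space \<Rightarrow> 'e::chilbert_space"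
    and V :: "complex \<times> 'e \<Rightarrow> complex \<times> 'f"
  assumes V: "unitary_operator V" and "\<And>v. norm (M v) = norm v"
    and "0 \<le> t" "t < 1" and eq: "V (1, t *\<^sub>R M y) = (a, y)"
  shows "(1 - t\<^sup>2) * (norm y)\<^sup>2 = 1 - (cmod a)\<^sup>2"
    and "norm (snd (inv V (0, y)) - M y) \<le> (1 - t) * norm y + 1"
proof -
  have "(norm (V (1, t *\<^sub>R M y)))\<^sup>2 = (norm (1 :: complex, t *\<^sub>R M y))\<^sup>2"
    by (simp add: unitary_norm[OF V])
  then show norms: "(1 - t\<^sup>2) * (norm y)\<^sup>2 = 1 - (cmod a)\<^sup>2"
    unfolding eq norm_Pair by (simp add: assms power_mult_distrib algebra_simps)
  have "0 \<le> (1 - t\<^sup>2) * (norm y)\<^sup>2"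
    using assms by (simp add: power_le_one)
  then have a: "cmod a \<le> 1"
    unfolding norms by (simp add: power_le_one_iff abs_square_le_1)
  have "(a, y) = (a, 0) + (0, y)" by simp
  then have "(1, t *\<^sub>R M y) = inv V (a, 0) + inv V (0, y)"
    by (metis eq unitary_inv_left[OF V] linear_add[OF unitary_inv_linear[OF V]])
  then have "snd (inv V (0, y)) = t *\<^sub>R M y - snd (inv V (a, 0))"
    by (metis add_diff_cancel_left' snd_add snd_conv)
  then have "snd (inv V (0, y)) - M y = - ((1 - t) *\<^sub>R M y) - snd (inv V (a, 0))"
    by (simp add: algebra_simps)
  also have "norm \<dots> \<le> (1 - t) * norm y + norm (inv V (a, 0))"
    by (rule order_trans[OF norm_triangle_ineq4])
      (use assms in \<open>auto intro!: add_mono norm_snd_le_norm\<close>)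
  also have "norm (inv V (a, 0)) = cmod a"
    by (simp add: unitary_inv_norm[OF V] norm_Pair)
  finally show "norm (snd (inv V (0, y)) - M y) \<le> (1 - t) * norm y + 1"
    using a by simp
qed

text \<open>
  For a coisometry \<open>M\<close> with adjoint \<open>N\<close> the roles of \<open>V\<close> and \<open>V\<^sup>*\<close> are exchanged: the solution of
  \<open>u = B\<^sup>*1 + tD\<^sup>*Nu\<close> is the state of the adjoint realization at the same radial point, and its
  output is the conjugate of \<open>a\<close>. The vector \<open>v = Nu\<close> lies in the range of \<open>N\<close>, where \<open>M\<close> preserves
  norms.
\<close>

lemma coisometric_eigenvector:
  fixes M :: "'f::chilbert_space \<Rightarrow> 'e::chilbert_space"
    and V :: "complex \<times> 'e \<Rightarrow> complex \<times> 'f"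
  assumes V: "unitary_operator V" and N: "linear N" "\<And>w. norm (N w) = norm w"
    and adj: "\<And>v w. cinner (M v) w = cinner v (N w)" and MN: "\<And>w. M (N w) = w"
    and t: "0 \<le> t" "t < 1" and eq: "V (1, t *\<^sub>R M y) = (a, y)"
  shows "\<exists>v. (1 - t\<^sup>2) * (norm v)\<^sup>2 = 1 - (cmod a)\<^sup>2 \<and>
    norm (snd (inv V (0, v)) - M v) \<le> (1 - t) * norm v + 1"
proof -
  note W = unitary_inv_linear[OF V]
  \<comment> \<open>In block form, \<open>b\<close> is \<open>B\<^sup>*1\<close> and \<open>S\<close> is \<open>D\<^sup>*\<close>.\<close>
  define b where "b = snd (inv V (1, 0))"
  define S where "S = (\<lambda>v. snd (inv V (0, v)))"
  have S: "linear S" unfolding S_def by (rule unitary_inv_corner_linear[OF V])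
  have norm_S: "norm (S v) \<le> norm v" for v
    using norm_snd_le_norm[of "inv V (0, v)"] by (simp add: S_def unitary_inv_norm[OF V] norm_Pair)
  have norm_b: "norm b \<le> 1"
    using norm_snd_le_norm[of "inv V (1, 0)"] by (simp add: b_def unitary_inv_norm[OF V] norm_Pair)
  have "\<exists>u. u = b + t *\<^sub>R S (N u)"
  proof (rule affine_contraction_fixpoint)
    show "linear (\<lambda>u. t *\<^sub>R S (N u))"
      using linear_compose_scale_right[OF linear_compose[OF N(1) S], of t] by (simp add: comp_def)
    show "norm (t *\<^sub>R S (N u)) \<le> t * norm u" for u
      using norm_S[of "N u"] t by (simp add: N mult_left_mono)
  qed (rule t)
  then obtain u where u: "u = b + t *\<^sub>R S (N u)" ..
  define c where "c = fst (inv V (1, t *\<^sub>R N u))"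
  have Wu: "inv V (1, t *\<^sub>R N u) = (c, u)"
  proof -
    have "(1, t *\<^sub>R N u) = (1, 0) + t *\<^sub>R (0, N u)" by simp
    then have "inv V (1, t *\<^sub>R N u) = inv V (1, 0) + t *\<^sub>R inv V (0, N u)"
      by (metis linear_add[OF W] linear_scale[OF W])
    then have "snd (inv V (1, t *\<^sub>R N u)) = b + t *\<^sub>R S (N u)"
      by (simp add: b_def S_def)
    then show ?thesis unfolding c_def using u by (metis prod.collapse)
  qed
  \<comment> \<open>The contributions of the states cancel, as \<open>\<langle>y, tNu\<rangle> = \<langle>tMy, u\<rangle>\<close>.\<close>
  have "cinner (a, y) (1, t *\<^sub>R N u) = cinner (1, t *\<^sub>R M y) (c, u)"
    by (metis eq Wu unitary_inv_adjoint[OF V])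
  then have "a = cnj c"
    by (simp add: cinner_prod_def cinner_complex_def cinner_scaleR_left cinner_scaleR_right adj)
  then have ac: "cmod a = cmod c" by simp
  have "(norm (inv V (1, t *\<^sub>R N u)))\<^sup>2 = (norm (1 :: complex, t *\<^sub>R N u))\<^sup>2"
    by (simp add: unitary_inv_norm[OF V])
  then have "(1 - t\<^sup>2) * (norm (N u))\<^sup>2 = 1 - (cmod a)\<^sup>2"
    unfolding Wu norm_Pair ac by (simp add: N power_mult_distrib algebra_simps)
  moreover have "norm (snd (inv V (0, N u)) - M (N u)) \<le> (1 - t) * norm (N u) + 1"
  proof -
    have "S (N u) - u = (1 - t) *\<^sub>R S (N u) - b"
      by (subst (2) u) (simp add: algebra_simps)
    also have "norm \<dots> \<le> (1 - t) * norm (N u) + 1"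
      by (rule order_trans[OF norm_triangle_ineq4])
        (use t norm_b norm_S in \<open>auto intro!: add_mono mult_left_mono\<close>)
    finally show ?thesis by (simp add: S_def MN)
  qed
  ultimately show ?thesis by blast
qed

lemma approx_spectrumI:
  assumes "\<And>e. e > 0 \<Longrightarrow> \<exists>v. norm v = 1 \<and> norm (T v - ampliation (pencil Q z) v) < e"
  shows "z \<in> approx_spectrum Q T"
proof -
  have "\<exists>v. norm v = 1 \<and> norm (T v - ampliation (pencil Q z) v) < inverse (real (Suc k))" for k
    by (rule assms) simp
  then obtain v where v: "\<And>k. norm (v k) = 1"
    "\<And>k. norm (T (v k) - ampliation (pencil Q z) (v k)) < inverse (real (Suc k))"
    by metis
  have "(\<lambda>k. norm (T (v k) - ampliation (pencil Q z) (v k))) \<longlonglongrightarrow> 0"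
    by (rule tendsto_sandwich[OF _ _ tendsto_const LIMSEQ_inverse_real_of_nat])
      (use v(2) in \<open>auto intro!: always_eventually less_imp_le\<close>)
  with v(1) show ?thesis unfolding approx_spectrum_def by blast
qed

lemma realization_approximate_eigenvector:
  fixes Q :: "'d::finite \<Rightarrow> complex ^ 'r::finite ^ 's::finite"
    and A :: "complex \<Rightarrow> complex"
    and B :: "'h::chilbert_space ^ 's \<Rightarrow> complex"
    and C :: "complex \<Rightarrow> 'h ^ 'r"
    and D :: "'h ^ 's \<Rightarrow> 'h ^ 'r"
  assumes lin: "bounded_clinear A" "bounded_clinear C" "bounded_clinear D"
    and V: "unitary_operator (block_operator A B C D)"
    and real: "\<forall>z\<in>matrix_ball Q.
      f z = A 1 + B (inv (\<lambda>x. x - ampliation (pencil Q z) (D x)) (ampliation (pencil Q z) (C 1)))"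
    and z: "z \<in> matrix_sphere Q" "z \<in> essential_boundary Q" and t: "0 \<le> t" "t < 1"
  shows "\<exists>v. (1 - t\<^sup>2) * (norm v)\<^sup>2 = 1 - (cmod (f (t *\<^sub>R z)))\<^sup>2 \<and>
    norm (cadjoint D v - ampliation (pencil Q z) v) \<le> (1 - t) * norm v + 1"
proof -
  let ?V = "block_operator A B C D"
  define M :: "'h ^ 'r \<Rightarrow> 'h ^ 's" where "M = ampliation (pencil Q z)"
  define N :: "'h ^ 's \<Rightarrow> 'h ^ 'r" where "N = ampliation (conj_transpose (pencil Q z))"
  have linA: "linear A" and linC: "linear C" and linD: "linear D"
    using lin by (auto simp: bounded_clinear_def bounded_linear.linear)
  have linM: "linear M" and linN: "linear N"
    by (simp_all add: M_def N_def linear_ampliation)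
  have adj: "cinner (M v) w = cinner v (N w)" for v w
    by (simp add: M_def N_def ampliation_adjoint)
  have ess: "(\<forall>v. norm (M v) = norm v) \<or> (\<forall>w. norm (N w) = norm w \<and> M (N w) = w)"
    using z(2) unfolding essential_boundary_def iso_boundary_def coiso_boundary_def M_def N_def
    by (auto simp: norm_ampliation_isometry conj_transpose_twice ampliation_mult[symmetric]
        ampliation_one)
  then have norm_M: "norm (M v) \<le> norm v" for v
    using norm_le_if_adjoint_isometric[of M N v] adj by (metis order_refl)
  have norm_D: "norm (D x) \<le> norm x" for x
  proof -
    have "norm (D x) \<le> norm (?V (0, x))"
      using norm_snd_le_norm[of "?V (0, x)"] linC by (simp add: block_operator_def linear_0)
    then show ?thesis by (simp add: unitary_norm[OF V] norm_Pair)
  qed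
  have linK: "linear (\<lambda>x. t *\<^sub>R M (D x))"
    using linear_compose_scale_right[OF linear_compose[OF linD linM], of t] by (simp add: comp_def)
  have norm_K: "norm (t *\<^sub>R M (D x)) \<le> t * norm x" for x
    using order_trans[OF norm_M norm_D, of x] t by (simp add: mult_left_mono)
  obtain x where x: "x = t *\<^sub>R M (C 1) + t *\<^sub>R M (D x)"
    using affine_contraction_fixpoint[OF linK t(2) norm_K] by blast
  define y where "y = C 1 + D x"
  have xy: "x = t *\<^sub>R M y"
    using x by (simp add: y_def linear_add[OF linM] scaleR_add_right)
  have inj: "inj (\<lambda>x. x - t *\<^sub>R M (D x))"
  proof (rule injI)
    fix p q assume "p - t *\<^sub>R M (D p) = q - t *\<^sub>R M (D q)"
    then have "p - q = t *\<^sub>R M (D (p - q))"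
      by (simp add: linear_diff[OF linM] linear_diff[OF linD] algebra_simps)
    then have "norm (p - q) \<le> t * norm (p - q)"
      using norm_K[of "p - q"] by simp
    then show "p = q"
      using t by (simp add: mult_le_cancel_right1)
  qed
  have amp: "ampliation (pencil Q (t *\<^sub>R z)) v = t *\<^sub>R M v" for v :: "'h ^ 'r"
    by (simp add: M_def pencil_scaleR ampliation_scaleR)
  have "inv (\<lambda>x. x - t *\<^sub>R M (D x)) (t *\<^sub>R M (C 1)) = x"
    by (rule inv_f_eq[OF inj]) (subst (1) x, simp)
  then have "f (t *\<^sub>R z) = A 1 + B x"
    using real radial_in_matrix_ball[OF z(1) t] by (simp add: amp)
  then have eq: "?V (1, t *\<^sub>R M y) = (f (t *\<^sub>R z), y)"
    unfolding xy[symmetric] by (simp add: block_operator_def y_def)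
  have adjD: "cadjoint D = (\<lambda>v. snd (inv ?V (0, v)))"
    by (rule cadjoint_block[OF linA linC V])
  from ess show ?thesis
  proof
    assume "\<forall>v. norm (M v) = norm v"
    then have iso: "norm (M v) = norm v" for v by blast
    show ?thesis
      unfolding adjD M_def[symmetric] using isometric_eigenvector[OF V iso t eq] by blast
  next
    assume "\<forall>w. norm (N w) = norm w \<and> M (N w) = w"
    then show ?thesis
      unfolding adjD M_def[symmetric]
      by (intro coisometric_eigenvector[OF V linN _ adj _ t eq]) auto
  qed
qed

theorem theorem5p9:
  fixes Q :: "'d::finite \<Rightarrow> complex ^ 'r::finite ^ 's::finite"
    and f :: "complex ^ 'd \<Rightarrow> complex"
    and A :: "complex \<Rightarrow> complex"
    and B :: "'h::chilbert_space ^ 's \<Rightarrow> complex"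
    and C :: "complex \<Rightarrow> 'h ^ 'r"
    and D :: "'h ^ 's \<Rightarrow> 'h ^ 'r"
  assumes "f \<in> schur_agler Q"
    and "\<not> f constant_on matrix_ball Q"
    and "bounded_clinear A" and "bounded_clinear B" and "bounded_clinear C" and "bounded_clinear D"
    and "unitary_operator (block_operator A B C D)"
    and "\<forall>z\<in>matrix_ball Q.
      f z = A 1 + B (inv (\<lambda>x. x - ampliation (pencil Q z) (D x)) (ampliation (pencil Q z) (C 1)))"
  shows "BP_one Q f \<inter> essential_boundary Q \<subseteq> approx_spectrum Q (cadjoint D)"
proof
  fix z assume "z \<in> BP_one Q f \<inter> essential_boundary Q"
  then obtain l where sphere: "z \<in> matrix_sphere Q" and ess: "z \<in> essential_boundary Q"
    and lim: "((\<lambda>t :: real. f (t *\<^sub>R z)) \<longlongrightarrow> l) (at_left 1)" and l: "cmod (radial_limit f z) < 1"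
    by (auto simp: BP_one_def BP_def)
  have "radial_limit f z = l"
    unfolding radial_limit_def by (rule tendsto_Lim[OF _ lim]) simp
  with l have l1: "(cmod l)\<^sup>2 < 1"
    by (simp add: abs_square_less_1)
  show "z \<in> approx_spectrum Q (cadjoint D)"
  proof (rule approx_spectrumI)
    fix e :: real assume "e > 0"
    \<comment> \<open>The square root is \<open>1 / \<parallel>v\<parallel>\<close> for the vector \<open>v\<close> belonging to \<open>t\<close>, so \<open>?g t\<close> bounds the
        error for the normalized vector.\<close>
    let ?g = "\<lambda>t. (1 - t) + sqrt ((1 - t\<^sup>2) / (1 - (cmod (f (t *\<^sub>R z)))\<^sup>2))"
    have "(?g \<longlongrightarrow> (1 - 1) + sqrt ((1 - 1\<^sup>2) / (1 - (cmod l)\<^sup>2))) (at_left 1)"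
      using l1 by (intro tendsto_intros lim) auto
    then have "\<forall>\<^sub>F t in at_left 1. ?g t < e"
      using \<open>e > 0\<close> by (intro order_tendstoD) auto
    moreover have "\<forall>\<^sub>F t in at_left 1. (cmod (f (t *\<^sub>R z)))\<^sup>2 < 1"
      using l1 by (intro order_tendstoD(2)[OF tendsto_power[OF tendsto_norm[OF lim]]])
    moreover have "\<forall>\<^sub>F t in at_left 1. t \<in> {0<..<1::real}"
      by (rule eventually_at_left_real) simp
    ultimately have "\<forall>\<^sub>F t in at_left 1.
        ?g t < e \<and> (cmod (f (t *\<^sub>R z)))\<^sup>2 < 1 \<and> t \<in> {0<..<1::real}"
      by (intro eventually_conj)
    then obtain t where g: "?g t < e" and ft: "(cmod (f (t *\<^sub>R z)))\<^sup>2 < 1" and t: "0 < t" "t < 1"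
      using eventually_happens' trivial_limit_at_left_real
      by (metis (mono_tags, lifting) greaterThanLessThan_iff)
    obtain v where v: "(1 - t\<^sup>2) * (norm v)\<^sup>2 = 1 - (cmod (f (t *\<^sub>R z)))\<^sup>2"
      "norm (cadjoint D v - ampliation (pencil Q z) v) \<le> (1 - t) * norm v + 1"
      using realization_approximate_eigenvector[OF assms(3,5,6,7,8) sphere ess, of t] t by auto
    have pos: "norm v > 0" using v(1) ft by (cases "v = 0") auto
    have t2: "t\<^sup>2 < 1" using t by (simp add: abs_square_less_1)
    have "(1 - t\<^sup>2) / (1 - (cmod (f (t *\<^sub>R z)))\<^sup>2) = (1 / norm v)\<^sup>2"
      unfolding v(1)[symmetric] using t2 pos by (simp add: field_simps)
    then have sq: "sqrt ((1 - t\<^sup>2) / (1 - (cmod (f (t *\<^sub>R z)))\<^sup>2)) = 1 / norm v"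
      by (simp add: real_sqrt_divide)
    let ?u = "v /\<^sub>R norm v"
    have linS: "linear (cadjoint D)"
      using cadjoint_block[OF _ _ assms(7)] unitary_inv_corner_linear[OF assms(7)] assms(3,5)
      by (simp add: bounded_clinear_def bounded_linear.linear)
    have "cadjoint D ?u - ampliation (pencil Q z) ?u
        = (cadjoint D v - ampliation (pencil Q z) v) /\<^sub>R norm v"
      by (simp add: linear_scale[OF linS] linear_scale[OF linear_ampliation] scaleR_diff_right)
    then have "norm (cadjoint D ?u - ampliation (pencil Q z) ?u)
        = norm (cadjoint D v - ampliation (pencil Q z) v) / norm v"
      by (simp add: divide_inverse mult.commute)
    also have "\<dots> \<le> ((1 - t) * norm v + 1) / norm v"
      using v(2) by (rule divide_right_mono) simp
    also have "\<dots> = ?g t" unfolding sq using pos by (simp add: field_simps)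
    also have "\<dots> < e" by (rule g)
    finally show "\<exists>u. norm u = 1 \<and> norm (cadjoint D u - ampliation (pencil Q z) u) < e"
      using pos by (intro exI[of _ ?u]) simp
  qed
qed

end
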